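(* Let $n\ge 2$ and let $\mathcal{C}$ be either $\mathcal{K}^n$ or $\mathcal{K}^n_o$. An operation $*:\mathcal{C}^2\to\mathcal{K}^n$ is projection covariant if and only if it is continuous and $GL(n)$ covariant (and hence homogeneous of degree $1$).
   Context: $\mathcal{K}^n$ is the class of nonempty compact convex subsets of $\mathbb{R}^n$; $\mathcal{K}^n_o$ is the subclass of those containing the origin. Properties of $*$ (for all $K,L,\dots\in\mathcal{C}$): projection covariant: $(K*L)|S=(K|S)*(L|S)$ for every linear subspace $S$ of $\mathbb{R}^n$ of dimension $k$, $1\le k\le n-1$, where $X|S$ is the orthogonal projection of $X$ onto $S$ (as a subset of $\mathbb{R}^n$); continuous: $K_m\to K$ and $L_m\to L$ (with all sets in $\mathcal{C}$) in the Hausdorff metric imply $K_m*L_m\to K*L$ in the Hausdorff metric; $GL(n)$ covariant: $\phi(K*L)=(\phi K)*(\phi L)$ for all $\phi\in GL(n)$; homogeneous of degree $1$: $(rK)*(rL)=r(K*L)$ for all $r\ge 0$. *)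

theory Defs
  imports "HOL-Analysis.Analysis"
begin

definition compact_convex_sets :: "(real ^ 'n) set set" where
  "compact_convex_sets = {K. K \<noteq> {} \<and> compact K \<and> convex K}"

definition compact_convex_sets_o :: "(real ^ 'n) set set" where
  "compact_convex_sets_o = {K \<in> compact_convex_sets. 0 \<in> K}"

text \<open>Only meaningful for nonempty bounded sets: the real-valued \<open>SUP\<close> is unspecified for families
  that are empty or not bounded above.\<close>

definition hausdorff_dist :: "'a::metric_space set \<Rightarrow> 'a set \<Rightarrow> real" where
  "hausdorff_dist A B = max (SUP a\<in>A. infdist a B) (SUP b\<in>B. infdist b A)"

definition hausdorff_tendsto :: "(nat \<Rightarrow> 'a::metric_space set) \<Rightarrow> 'a set \<Rightarrow> bool" where
  "hausdorff_tendsto X A \<longleftrightarrow> (\<lambda>m. hausdorff_dist (X m) A) \<longlonglongrightarrow> 0"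

definition orth_proj :: "'a::euclidean_space set \<Rightarrow> 'a \<Rightarrow> 'a" where
  "orth_proj S x = (THE y. y \<in> S \<and> (\<forall>z\<in>S. orthogonal (x - y) z))"

lemma orth_proj_ex1:
  fixes S :: "'a::euclidean_space set"
  assumes "subspace S"
  shows "\<exists>!y. y \<in> S \<and> (\<forall>z\<in>S. orthogonal (x - y) z)"
proof -
  obtain y z where "y \<in> span S" "\<And>w. w \<in> span S \<Longrightarrow> orthogonal z w" "x = y + z"
    using orthogonal_subspace_decomp_exists[of S x] by blast
  then have ex: "y \<in> S \<and> (\<forall>z\<in>S. orthogonal (x - y) z)"
    using assms by (simp add: span_eq_iff[THEN iffD2])
  moreover have "y' = y" if "y' \<in> S \<and> (\<forall>z\<in>S. orthogonal (x - y') z)" for y'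
  proof -
    have d: "y' - y \<in> S" using that ex assms by (simp add: subspace_diff)
    have "(x - y) \<bullet> (y' - y) = 0" "(x - y') \<bullet> (y' - y) = 0"
      using that ex d by (auto simp: orthogonal_def)
    then have "(y' - y) \<bullet> (y' - y) = 0" by (simp add: inner_diff_left)
    then show ?thesis by simp
  qed
  ultimately show ?thesis by blast
qed

text \<open>A binary operation on a class \<open>C\<close> of subsets of \<open>real ^ 'n\<close> is a total HOL function of which
  only the values at arguments in \<open>C\<close> matter.\<close>

definition projection_covariant ::
    "(real ^ 'n) set set \<Rightarrow> ((real ^ 'n) set \<Rightarrow> (real ^ 'n) set \<Rightarrow> (real ^ 'n) set) \<Rightarrow> bool" where
  "projection_covariant C opr \<longleftrightarrow>
    (\<forall>K\<in>C. \<forall>L\<in>C. \<forall>S. subspace S \<and> 1 \<le> dim S \<and> dim S \<le> CARD('n) - 1 \<longrightarrow>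
      orth_proj S ` opr K L = opr (orth_proj S ` K) (orth_proj S ` L))"

definition hausdorff_continuous ::
    "(real ^ 'n) set set \<Rightarrow> ((real ^ 'n) set \<Rightarrow> (real ^ 'n) set \<Rightarrow> (real ^ 'n) set) \<Rightarrow> bool" where
  "hausdorff_continuous C opr \<longleftrightarrow>
    (\<forall>Ks Ls K L. range Ks \<subseteq> C \<and> range Ls \<subseteq> C \<and> K \<in> C \<and> L \<in> C \<and>
      hausdorff_tendsto Ks K \<and> hausdorff_tendsto Ls L \<longrightarrow>
      hausdorff_tendsto (\<lambda>m. opr (Ks m) (Ls m)) (opr K L))"

definition GL_covariant ::
    "(real ^ 'n) set set \<Rightarrow> ((real ^ 'n) set \<Rightarrow> (real ^ 'n) set \<Rightarrow> (real ^ 'n) set) \<Rightarrow> bool" where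
  "GL_covariant C opr \<longleftrightarrow>
    (\<forall>K\<in>C. \<forall>L\<in>C. \<forall>A :: real ^ 'n ^ 'n. invertible A \<longrightarrow>
      (*v) A ` opr K L = opr ((*v) A ` K) ((*v) A ` L))"

definition homogeneous_degree_1 ::
    "(real ^ 'n) set set \<Rightarrow> ((real ^ 'n) set \<Rightarrow> (real ^ 'n) set \<Rightarrow> (real ^ 'n) set) \<Rightarrow> bool" where
  "homogeneous_degree_1 C opr \<longleftrightarrow>
    (\<forall>K\<in>C. \<forall>L\<in>C. \<forall>r\<ge>0.
      opr ((*\<^sub>R) r ` K) ((*\<^sub>R) r ` L) = (*\<^sub>R) r ` opr K L)"

end

theory Submission
  imports Defs
begin

text \<open>If \<open>*\<close> is continuous and \<open>GL(n)\<close> covariant, it commutes with the projection \<open>P\<close> onto \<open>S\<close>,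
  since \<open>P\<close> is the limit of the invertible maps \<open>P + (1 - P) / m\<close>.

  Conversely, let \<open>*\<close> be projection covariant. If \<open>y\<close> is the projection of \<open>x\<close> onto the line through
  \<open>y\<close>, then \<open>(I x) * (J x)\<close> and \<open>(I y) * (J y)\<close> are the same multiples of \<open>x\<close> and of \<open>y\<close>. Any two
  linearly independent vectors are projections of a common vector, so \<open>(I x) * (J x) = \<Phi>(I, J) x\<close> with
  an operation \<open>\<Phi>\<close> on intervals independent of \<open>x\<close>, and \<open>\<Phi>\<close> gives the image of \<open>K * L\<close> under every
  nonzero linear functional. This yields \<open>GL(n)\<close> covariance. Applying it to several functionals on one
  planar pair shows that \<open>\<Phi>\<close> is subadditive and monotone. Hence so is \<open>*\<close>, and with the unit ball
  \<open>B\<close> we get \<open>K * L \<subseteq> (K' + e B) * (L' + e B) \<subseteq> K' * L' + e (B * B)\<close> whenever \<open>K\<close>, \<open>K'\<close> and \<open>L\<close>, \<open>L'\<close>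
  have Hausdorff distance at most \<open>e\<close>: the operation is Lipschitz.\<close>

subsection \<open>Orthogonal projections and the Hausdorff distance\<close>

lemma orth_proj_eqI:
  assumes "subspace S" "y \<in> S" "\<And>z. z \<in> S \<Longrightarrow> orthogonal (x - y) z"
  shows "orth_proj S x = y"
  unfolding orth_proj_def
  by (rule the1_equality[OF orth_proj_ex1[OF assms(1)]]) (use assms in auto)

lemma
  assumes "subspace S"
  shows orth_proj_mem: "orth_proj S x \<in> S"
    and orth_proj_orthogonal: "z \<in> S \<Longrightarrow> orthogonal (x - orth_proj S x) z"
  using theI'[OF orth_proj_ex1[OF assms, of x]] unfolding orth_proj_def by blast+

lemma linear_orth_proj:
  assumes S: "subspace S"
  shows "linear (orth_proj S)"
proof (rule linearI)
  fix x y :: 'a and c :: real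
  show "orth_proj S (x + y) = orth_proj S x + orth_proj S y"
  proof (rule orth_proj_eqI[OF S])
    fix z assume "z \<in> S"
    then have "orthogonal (x - orth_proj S x) z" "orthogonal (y - orth_proj S y) z"
      using orth_proj_orthogonal[OF S] by blast+
    then show "orthogonal (x + y - (orth_proj S x + orth_proj S y)) z"
      by (simp add: orthogonal_def inner_diff_left inner_add_left)
  qed (simp add: S orth_proj_mem subspace_add)
  show "orth_proj S (c *\<^sub>R x) = c *\<^sub>R orth_proj S x"
  proof (rule orth_proj_eqI[OF S])
    fix z assume "z \<in> S"
    then have "orthogonal (x - orth_proj S x) z"
      using orth_proj_orthogonal[OF S] by blast
    then show "orthogonal (c *\<^sub>R x - c *\<^sub>R orth_proj S x) z"
      by (simp add: orthogonal_def inner_diff_left)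
  qed (simp add: S orth_proj_mem subspace_scale)
qed

lemma orth_proj_span_singleton:
  "orth_proj (span {u}) x = ((x \<bullet> u) / (u \<bullet> u)) *\<^sub>R u"
  by (rule orth_proj_eqI)
    (auto simp: span_breakdown_eq orthogonal_def inner_diff_left intro: span_base span_scale)

text \<open>The hypothesis says that \<open>u\<close> is the projection of \<open>x\<close> onto the
  line through \<open>u\<close>, so every coefficient is kept.\<close>

lemma orth_proj_scaleR_image:
  assumes "u \<bullet> x = u \<bullet> u" "u \<noteq> 0"
  shows "orth_proj (span {u}) ` (\<lambda>s. s *\<^sub>R x) ` I = (\<lambda>s. s *\<^sub>R u) ` I"
  using assms by (simp add: image_image orth_proj_span_singleton inner_commute)

lemma compact_imp_bdd_above_infdist:
  assumes "compact A"
  shows "bdd_above ((\<lambda>a. infdist a B) ` A)"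
  by (intro bounded_imp_bdd_above compact_imp_bounded compact_continuous_image
      continuous_intros assms)

lemma hausdorff_dist_commute: "hausdorff_dist A B = hausdorff_dist B A"
  by (simp add: hausdorff_dist_def max.commute)

lemma infdist_le_hausdorff_dist:
  assumes "compact A" "a \<in> A"
  shows "infdist a B \<le> hausdorff_dist A B"
  using cSUP_upper[OF assms(2) compact_imp_bdd_above_infdist[OF assms(1)], of B]
  by (simp add: hausdorff_dist_def)

lemma hausdorff_dist_nonneg:
  assumes "compact A" "A \<noteq> {}"
  shows "0 \<le> hausdorff_dist A B"
  using assms by (metis all_not_in_conv infdist_le_hausdorff_dist infdist_nonneg order_trans)

lemma subset_plus_cball_hausdorff_dist:
  fixes A B :: "'a::euclidean_space set"
  assumes "compact A" "compact B" "B \<noteq> {}" "hausdorff_dist A B \<le> e"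
  shows "A \<subseteq> B + cball 0 e"
proof
  fix a assume "a \<in> A"
  then have "infdist a B \<le> e"
    using infdist_le_hausdorff_dist[OF \<open>compact A\<close>, of a B] assms(4) by linarith
  moreover obtain b where "b \<in> B" "infdist a B = dist a b"
    using infdist_attains_inf[of B a] assms compact_imp_closed by blast
  ultimately have "b \<in> B" "a - b \<in> cball 0 e"
    by (auto simp: dist_norm norm_minus_commute)
  then have "b + (a - b) \<in> B + cball 0 e"
    by (rule set_plus_intro)
  then show "a \<in> B + cball 0 e"
    by simp
qed

lemma hausdorff_dist_leI:
  fixes A B :: "'a::euclidean_space set"
  assumes "A \<noteq> {}" "B \<noteq> {}"
    and "\<And>a. a \<in> A \<Longrightarrow> \<exists>b\<in>B. dist a b \<le> e" "\<And>b. b \<in> B \<Longrightarrow> \<exists>a\<in>A. dist a b \<le> e"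
  shows "hausdorff_dist A B \<le> e"
  unfolding hausdorff_dist_def
proof (rule max.boundedI)
  show "(SUP a\<in>A. infdist a B) \<le> e"
    by (intro cSUP_least) (use assms in \<open>auto intro: infdist_le2\<close>)
  show "(SUP b\<in>B. infdist b A) \<le> e"
    by (intro cSUP_least) (use assms in \<open>auto intro: infdist_le2 simp: dist_commute\<close>)
qed

lemma hausdorff_dist_le_plus_cball:
  fixes A B :: "'a::euclidean_space set"
  assumes "A \<noteq> {}" "B \<noteq> {}" "A \<subseteq> B + cball 0 e" "B \<subseteq> A + cball 0 e"
  shows "hausdorff_dist A B \<le> e"
proof (rule hausdorff_dist_leI[OF assms(1,2)])
  show "\<exists>b\<in>B. dist a b \<le> e" if "a \<in> A" for a
    using subsetD[OF assms(3) that] by (force simp: set_plus_def dist_norm)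
  show "\<exists>a\<in>A. dist a b \<le> e" if "b \<in> B" for b
    using subsetD[OF assms(4) that] by (force simp: set_plus_def dist_norm)
qed

text \<open>A point of \<open>A\<close> is near \<open>X m\<close>, whose points are near
  \<open>B\<close>; the triangle inequality carries this to the limit. Uniqueness of limits follows
  by symmetry.\<close>

lemma hausdorff_tendsto_subset:
  fixes A B :: "'a::euclidean_space set"
  assumes X: "\<And>m. compact (X m)" "\<And>m. X m \<noteq> {}" and "compact A" "compact B" "B \<noteq> {}"
    and lim: "hausdorff_tendsto X A" "hausdorff_tendsto X B"
  shows "A \<subseteq> B"
proof
  fix a assume a: "a \<in> A"
  have "infdist a B \<le> hausdorff_dist (X m) A + hausdorff_dist (X m) B" for m
  proof -
    obtain x where x: "x \<in> X m" "infdist a (X m) = dist a x"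
      using infdist_attains_inf[of "X m" a] X compact_imp_closed by blast
    have "infdist a B \<le> infdist x B + dist a x"
      by (rule infdist_triangle)
    moreover have "infdist x B \<le> hausdorff_dist (X m) B"
      using infdist_le_hausdorff_dist X x by blast
    moreover have "infdist a (X m) \<le> hausdorff_dist (X m) A"
      using infdist_le_hausdorff_dist[OF \<open>compact A\<close> a, of "X m"]
      by (simp add: hausdorff_dist_commute[of A])
    ultimately show ?thesis
      using x by simp
  qed
  moreover have "(\<lambda>m. hausdorff_dist (X m) A + hausdorff_dist (X m) B) \<longlonglongrightarrow> 0 + 0"
    using lim unfolding hausdorff_tendsto_def by (rule tendsto_add)
  ultimately have "infdist a B \<le> 0"
    by (intro LIMSEQ_le_const[where X = "\<lambda>m. hausdorff_dist (X m) A + hausdorff_dist (X m) B"]) auto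
  then have "infdist a B = 0"
    using infdist_nonneg[of a B] by linarith
  then show "a \<in> B"
    using in_closed_iff_infdist_zero[of B a] assms compact_imp_closed by blast
qed

lemma hausdorff_tendsto_unique:
  fixes A B :: "'a::euclidean_space set"
  assumes "\<And>m. compact (X m)" "\<And>m. X m \<noteq> {}" "compact A" "compact B" "A \<noteq> {}" "B \<noteq> {}"
    and "hausdorff_tendsto X A" "hausdorff_tendsto X B"
  shows "A = B"
  by (rule subset_antisym; rule hausdorff_tendsto_subset[of X]) (use assms in auto)

text \<open>A point outside \<open>Y\<close> is strictly separated from it by a hyperplane, whose
  normal violates \<open>sub\<close>. Inclusions between convex bodies thus reduce to inclusions of
  intervals.\<close>

lemma subset_if_projections_subset:
  fixes X Y :: "'a::euclidean_space set"
  assumes Y: "compact Y" "convex Y" "Y \<noteq> {}"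
    and sub: "\<And>u. u \<noteq> 0 \<Longrightarrow> (\<lambda>z. z \<bullet> u) ` X \<subseteq> (\<lambda>z. z \<bullet> u) ` Y"
  shows "X \<subseteq> Y"
proof
  fix z assume z: "z \<in> X"
  show "z \<in> Y"
  proof (rule ccontr)
    assume "z \<notin> Y"
    then obtain a b where ab: "a \<bullet> z < b" "\<forall>x\<in>Y. a \<bullet> x > b"
      using separating_hyperplane_closed_point[of Y z] Y compact_imp_closed by blast
    with Y have "a \<noteq> 0"
      by fastforce
    from sub[OF this] z obtain y where "y \<in> Y" "z \<bullet> a = y \<bullet> a"
      by blast
    with ab show False
      by (metis inner_commute not_less_iff_gr_or_eq)
  qed
qed

subsection \<open>Convex bodies\<close>

text \<open>\<open>convex_body False\<close> describes \<open>compact_convex_sets\<close> and \<open>convex_body True\<close> describes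
  \<open>compact_convex_sets_o\<close>, but in any Euclidean space.\<close>

definition convex_body :: "bool \<Rightarrow> 'a::euclidean_space set \<Rightarrow> bool" where
  "convex_body z K \<longleftrightarrow> K \<noteq> {} \<and> compact K \<and> convex K \<and> (z \<longrightarrow> 0 \<in> K)"

lemma compact_linear_image:
  fixes f :: "'a::euclidean_space \<Rightarrow> 'b::real_normed_vector"
  assumes "linear f" "compact K"
  shows "compact (f ` K)"
  using assms by (simp add: compact_continuous_image linear_continuous_on linear_conv_bounded_linear)

lemma convex_body_linear_image:
  assumes "linear f" "convex_body z K"
  shows "convex_body z (f ` K)"
  using assms image_eqI[of 0 f 0 K] linear_0[OF assms(1)]
  by (auto simp: convex_body_def compact_linear_image convex_linear_image)

lemma convex_body_scaleR_image: "convex_body z I \<Longrightarrow> convex_body z ((\<lambda>s::real. s *\<^sub>R x) ` I)"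
  by (rule convex_body_linear_image) (auto intro: linearI simp: scaleR_add_left)

lemma convex_body_inner_image: "convex_body z X \<Longrightarrow> convex_body z ((\<lambda>v. v \<bullet> u) ` X)"
  by (rule convex_body_linear_image) (auto intro: linearI simp: inner_add_left)

lemma convex_body_Times: "convex_body z I \<Longrightarrow> convex_body z J \<Longrightarrow> convex_body z (I \<times> J)"
  by (auto simp: convex_body_def compact_Times convex_Times zero_prod_def)

lemma convex_body_plus: "convex_body z K \<Longrightarrow> convex_body z L \<Longrightarrow> convex_body z (K + L)"
  unfolding set_plus_image
  by (rule convex_body_linear_image) (auto intro!: linearI convex_body_Times simp: scaleR_add_right)

lemma convex_body_cball: "0 \<le> e \<Longrightarrow> convex_body z (cball 0 e)"
  by (auto simp: convex_body_def)

lemma convex_body_weaken: "convex_body z K \<Longrightarrow> convex_body False K"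
  by (simp add: convex_body_def)

lemma ex_common_preimage_of_projections:
  fixes x y :: "'a::real_inner"
  assumes "(x \<bullet> x) * (y \<bullet> y) - (x \<bullet> y)\<^sup>2 \<noteq> 0"
  obtains z where "z \<bullet> x = x \<bullet> x" "z \<bullet> y = y \<bullet> y"
proof
  \<comment> \<open>The coefficients of \<open>z\<close> come from Cramer's rule for the two
    equations on a vector in the span of \<open>x\<close> and \<open>y\<close>; \<open>D\<close> is
    their Gram determinant.\<close>
  define D where "D = (x \<bullet> x) * (y \<bullet> y) - (x \<bullet> y)\<^sup>2"
  define z where "z = (((y \<bullet> y) * (x \<bullet> x - x \<bullet> y)) / D) *\<^sub>R x + (((x \<bullet> x) * (y \<bullet> y - x \<bullet> y)) / D) *\<^sub>R y"
  have D: "D \<noteq> 0"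
    using assms by (simp add: D_def)
  have "z \<bullet> x = ((y \<bullet> y) * (x \<bullet> x - x \<bullet> y) * (x \<bullet> x) + (x \<bullet> x) * (y \<bullet> y - x \<bullet> y) * (x \<bullet> y)) / D"
    by (simp add: z_def inner_add_left inner_commute[of y x] add_divide_distrib)
  also have "(y \<bullet> y) * (x \<bullet> x - x \<bullet> y) * (x \<bullet> x) + (x \<bullet> x) * (y \<bullet> y - x \<bullet> y) * (x \<bullet> y) = (x \<bullet> x) * D"
    by (simp add: D_def algebra_simps power2_eq_square)
  finally show "z \<bullet> x = x \<bullet> x"
    using D by simp
  have "z \<bullet> y = ((y \<bullet> y) * (x \<bullet> x - x \<bullet> y) * (x \<bullet> y) + (x \<bullet> x) * (y \<bullet> y - x \<bullet> y) * (y \<bullet> y)) / D"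
    by (simp add: z_def inner_add_left add_divide_distrib)
  also have "(y \<bullet> y) * (x \<bullet> x - x \<bullet> y) * (x \<bullet> y) + (x \<bullet> x) * (y \<bullet> y - x \<bullet> y) * (y \<bullet> y) = (y \<bullet> y) * D"
    by (simp add: D_def algebra_simps power2_eq_square)
  finally show "z \<bullet> y = y \<bullet> y"
    using D by simp
qed

subsection \<open>Continuous and GL covariant operations\<close>

lemma projection_covariant_if_continuous_GL_covariant:
  fixes opr :: "(real ^ 'n) set \<Rightarrow> (real ^ 'n) set \<Rightarrow> (real ^ 'n) set"
  assumes C: "C = Collect (convex_body z)"
    and opr: "\<And>K L. K \<in> C \<Longrightarrow> L \<in> C \<Longrightarrow> convex_body False (opr K L)"
    and cont: "hausdorff_continuous C opr" and GL: "GL_covariant C opr"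
    and K: "K \<in> C" and L: "L \<in> C" and S: "subspace S"
  shows "orth_proj S ` opr K L = opr (orth_proj S ` K) (orth_proj S ` L)"
proof -
  define P where "P = orth_proj S"
  \<comment> \<open>\<open>Suc m\<close> avoids the default value 1 / 0 = 0, for which
    \<open>f m\<close> would be \<open>P\<close> itself; \<open>f 0\<close> is the identity.\<close>
  define f where "f m x = P x + (1 / real (Suc m)) *\<^sub>R (x - P x)" for m x
  note linP = linear_orth_proj[OF S, folded P_def]
  have linf: "linear (f m)" for m
    unfolding f_def
    by (intro linear_compose_add linear_compose_scale_right linear_compose_sub linP linear_ident)
  have PP: "P (P x) = P x" for x
    unfolding P_def by (rule orth_proj_eqI[OF S]) (simp_all add: orth_proj_mem[OF S] orthogonal_def)
  have injf: "inj (f m)" for m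
  proof (rule linear_injective_0[THEN iffD2, OF linf], intro allI impI)
    fix x assume 0: "f m x = 0"
    have "P (f m x) = P x"
      by (simp add: f_def linear_add[OF linP] linear_scale[OF linP] linear_diff[OF linP] PP)
    with 0 have "P x = 0"
      by (simp add: linear_0[OF linP])
    with 0 show "x = 0"
      by (simp add: f_def)
  qed
  have f_image: "f m ` opr K L = opr (f m ` K) (f m ` L)" for m
  proof -
    have "(*v) (matrix (f m)) = f m"
      using matrix_vector_mul(2)[OF linf] .
    moreover have "invertible (matrix (f m))"
      using injf[of m] calculation by (metis invertible_left_inverse matrix_left_invertible_injective)
    ultimately show ?thesis
      using GL K L unfolding GL_covariant_def by metis
  qed
  have lim: "hausdorff_tendsto (\<lambda>m. f m ` X) (P ` X)" if "convex_body False X" for X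
  proof -
    have X: "compact X" "X \<noteq> {}"
      using that by (auto simp: convex_body_def)
    have "bounded ((\<lambda>x. x - P x) ` X)"
      by (intro compact_imp_bounded compact_linear_image X linear_compose_sub linP linear_ident)
    then obtain R where R: "\<And>x. x \<in> X \<Longrightarrow> norm (x - P x) \<le> R"
      by (auto simp: bounded_iff)
    have "dist (f m x) (P x) \<le> R / real (Suc m)" if "x \<in> X" for m x
      using R[OF that] by (simp add: f_def dist_norm divide_right_mono)
    then have le: "hausdorff_dist (f m ` X) (P ` X) \<le> R / real (Suc m)" for m
      using X by (intro hausdorff_dist_leI) auto
    have "(\<lambda>m. R / real (Suc m)) \<longlonglongrightarrow> 0"
      by (rule LIMSEQ_Suc[OF lim_const_over_n])
    moreover have "0 \<le> hausdorff_dist (f m ` X) (P ` X)" for m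
      using X linf by (intro hausdorff_dist_nonneg compact_linear_image) auto
    ultimately show ?thesis
      unfolding hausdorff_tendsto_def
      by (rule_tac tendsto_sandwich[where f = "\<lambda>_. 0" and h = "\<lambda>m. R / real (Suc m)"])
        (auto intro: always_eventually le simp del: of_nat_Suc)
  qed
  have inC: "g ` X \<in> C" if "linear g" "X \<in> C" for g X
    using that by (simp add: C convex_body_linear_image)
  have K': "convex_body False K" and L': "convex_body False L"
    using K L by (auto simp: C intro: convex_body_weaken)
  note body = convex_body_linear_image[OF linf opr[OF K L]] convex_body_linear_image[OF linP opr[OF K L]]
    opr[OF inC[OF linP K] inC[OF linP L]]
  have "hausdorff_tendsto (\<lambda>m. opr (f m ` K) (f m ` L)) (opr (P ` K) (P ` L))"
    using cont[unfolded hausdorff_continuous_def, rule_format,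
        of "\<lambda>m. f m ` K" "\<lambda>m. f m ` L" "P ` K" "P ` L"]
      lim[OF K'] lim[OF L'] inC[OF linP] inC[OF linf] K L by blast
  \<comment> \<open>The images of \<open>opr K L\<close> under \<open>f m\<close> converge to both
    sides: to the left directly, to the right by continuity once covariance has moved
    \<open>f m\<close> inside.\<close>
  then have "P ` opr K L = opr (P ` K) (P ` L)"
    using body lim[OF opr[OF K L]]
    by (intro hausdorff_tendsto_unique[of "\<lambda>m. f m ` opr K L"]) (auto simp: f_image convex_body_def)
  then show ?thesis
    by (simp add: P_def)
qed

lemma GL_covariant_scaleR:
  fixes opr :: "(real ^ 'n) set \<Rightarrow> (real ^ 'n) set \<Rightarrow> (real ^ 'n) set"
  assumes "GL_covariant C opr" "K \<in> C" "L \<in> C" "r \<noteq> 0"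
  shows "opr ((*\<^sub>R) r ` K) ((*\<^sub>R) r ` L) = (*\<^sub>R) r ` opr K L"
proof -
  have "(*v) (mat r) = ((*\<^sub>R) r :: real^'n \<Rightarrow> real^'n)"
    by (auto simp: fun_eq_iff vec_eq_iff matrix_vector_mult_def mat_def if_distrib if_distribR
        cong: if_cong)
  moreover have "invertible (mat r :: real^'n^'n)"
    using \<open>r \<noteq> 0\<close> by (simp add: invertible_det_nz det_diagonal mat_def)
  ultimately show ?thesis
    using assms unfolding GL_covariant_def by metis
qed


subsection \<open>Projection covariant operations\<close>

text \<open>The distinct indices encode n \<ge> 2 and later span the plane into which planar bodies
  are embedded; \<open>z\<close> selects the class.\<close>

locale projection_covariant_operation =
  fixes z :: bool and opr :: "(real ^ 'n) set \<Rightarrow> (real ^ 'n) set \<Rightarrow> (real ^ 'n) set" and i j :: 'n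
  assumes ij: "i \<noteq> j"
    and opr_body: "\<And>K L. convex_body z K \<Longrightarrow> convex_body z L \<Longrightarrow> convex_body False (opr K L)"
    and proj: "projection_covariant (Collect (convex_body z)) opr"
begin

section \<open>Reduction to a single operation on intervals\<close>

definition line_opr :: "real ^ 'n \<Rightarrow> real set \<Rightarrow> real set \<Rightarrow> real set" where
  "line_opr x I J = {s. s *\<^sub>R x \<in> opr ((\<lambda>s. s *\<^sub>R x) ` I) ((\<lambda>s. s *\<^sub>R x) ` J)}"

text \<open>By \<open>line_opr_indep\<close> below, the choice of the vector \<open>axis i 1\<close> is immaterial.\<close>

definition interval_opr :: "real set \<Rightarrow> real set \<Rightarrow> real set" where
  "interval_opr = line_opr (axis i 1)"

lemma two_le_card: "2 \<le> CARD('n)"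
  using card_mono[of UNIV "{i, j}"] ij by simp

text \<open>A line is an admissible subspace because 1 \<le> n - 1.\<close>

lemma opr_project_line:
  assumes "convex_body z K" "convex_body z L" "u \<noteq> 0"
  shows "orth_proj (span {u}) ` opr K L = opr (orth_proj (span {u}) ` K) (orth_proj (span {u}) ` L)"
  using assms proj two_le_card unfolding projection_covariant_def by simp

text \<open>The projection onto the line fixes both arguments, hence also their value. So the value
  lies on the line, and \<open>line_opr\<close> loses nothing.\<close>

lemma opr_on_line:
  assumes "convex_body z I" "convex_body z J" "x \<noteq> 0"
  shows "opr ((\<lambda>s. s *\<^sub>R x) ` I) ((\<lambda>s. s *\<^sub>R x) ` J) = (\<lambda>s. s *\<^sub>R x) ` line_opr x I J"
proof -
  let ?X = "opr ((\<lambda>s. s *\<^sub>R x) ` I) ((\<lambda>s. s *\<^sub>R x) ` J)"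
  have "?X = orth_proj (span {x}) ` ?X"
    using opr_project_line[OF convex_body_scaleR_image[OF assms(1)] convex_body_scaleR_image[OF assms(2)] assms(3)]
    by (simp add: orth_proj_scaleR_image assms(3))
  also have "\<dots> \<subseteq> range (\<lambda>s. s *\<^sub>R x)"
    by (auto simp: orth_proj_span_singleton)
  finally show ?thesis
    by (auto simp: line_opr_def)
qed

lemma line_opr_project:
  assumes I: "convex_body z I" and J: "convex_body z J" and "u \<noteq> 0" "u \<bullet> x = u \<bullet> u"
  shows "line_opr x I J = line_opr u I J"
proof -
  have "x \<noteq> 0"
    using assms by auto
  have "(\<lambda>s. s *\<^sub>R u) ` line_opr u I J = (\<lambda>s. s *\<^sub>R u) ` line_opr x I J"
    using opr_project_line[OF convex_body_scaleR_image[OF I] convex_body_scaleR_image[OF J], of u x x]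
    by (simp add: assms \<open>x \<noteq> 0\<close> opr_on_line orth_proj_scaleR_image)
  moreover have "inj (\<lambda>s. s *\<^sub>R u)"
    using \<open>u \<noteq> 0\<close> by (simp add: inj_on_def)
  ultimately show ?thesis
    by (simp add: inj_image_eq_iff)
qed

lemma line_opr_indep:
  assumes I: "convex_body z I" and J: "convex_body z J" and nz: "x \<noteq> 0" "y \<noteq> 0"
  shows "line_opr x I J = line_opr y I J"
proof -
  have *: "line_opr x I J = line_opr y I J"
    if "(x \<bullet> x) * (y \<bullet> y) - (x \<bullet> y)\<^sup>2 \<noteq> 0" "x \<noteq> 0" "y \<noteq> 0" for x y
  proof -
    obtain w where "w \<bullet> x = x \<bullet> x" "w \<bullet> y = y \<bullet> y"
      using ex_common_preimage_of_projections \<open>(x \<bullet> x) * (y \<bullet> y) - (x \<bullet> y)\<^sup>2 \<noteq> 0\<close> by blast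
    then show ?thesis
      using line_opr_project[OF I J, of x w] line_opr_project[OF I J, of y w] that
      by (simp add: inner_commute)
  qed
  show ?thesis
  proof (cases "(x \<bullet> x) * (y \<bullet> y) - (x \<bullet> y)\<^sup>2 = 0")
    case True
    then have "(x \<bullet> y)\<^sup>2 = (norm x * norm y)\<^sup>2"
      by (simp add: power_mult_distrib power2_norm_eq_inner)
    then have "\<bar>x \<bullet> y\<bar> = \<bar>norm x * norm y\<bar>"
      by (simp only: power2_eq_iff abs_eq_iff)
    then have "\<bar>x \<bullet> y\<bar> = norm x * norm y"
      by simp
    then have "norm x *\<^sub>R y = norm y *\<^sub>R x \<or> norm x *\<^sub>R y = - norm y *\<^sub>R x"
      using norm_cauchy_schwarz_abs_eq[of x y] by simp
    then obtain c where c: "norm x *\<^sub>R y = c *\<^sub>R x"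
      by blast
    \<comment> \<open>Equality in Cauchy-Schwarz has made \<open>x\<close> and \<open>y\<close>
      parallel. A vector orthogonal to both is independent of each and serves as
      intermediary.\<close>
    obtain w where w: "w \<noteq> 0" "orthogonal x w"
      using orthogonal_to_vector_exists[of x] two_le_card by auto
    then have "norm x * (y \<bullet> w) = 0"
      using arg_cong[OF c, of "\<lambda>v. v \<bullet> w"] by (simp add: orthogonal_def)
    then have "x \<bullet> w = 0" "y \<bullet> w = 0"
      using w nz by (auto simp: orthogonal_def)
    then show ?thesis
      using *[of x w] *[of y w] w(1) nz by simp
  qed (use * nz in blast)
qed

lemma projections_opr:
  assumes K: "convex_body z K" and L: "convex_body z L" and u: "u \<noteq> 0"
  shows "(\<lambda>v. v \<bullet> u) ` opr K L = interval_opr ((\<lambda>v. v \<bullet> u) ` K) ((\<lambda>v. v \<bullet> u) ` L)"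
proof -
  \<comment> \<open>With this scaling, the projection of \<open>v\<close> onto the line through
    \<open>u\<close> is \<open>x\<close> times the value of the functional at
    \<open>v\<close>.\<close>
  define x where "x = (1 / (u \<bullet> u)) *\<^sub>R u"
  have x: "x \<noteq> 0"
    using u by (simp add: x_def)
  have P: "orth_proj (span {u}) ` X = (\<lambda>s. s *\<^sub>R x) ` (\<lambda>v. v \<bullet> u) ` X" for X
    by (simp add: image_image x_def orth_proj_span_singleton)
  note body = convex_body_inner_image
  have "(\<lambda>s. s *\<^sub>R x) ` (\<lambda>v. v \<bullet> u) ` opr K L
      = (\<lambda>s. s *\<^sub>R x) ` line_opr x ((\<lambda>v. v \<bullet> u) ` K) ((\<lambda>v. v \<bullet> u) ` L)"
    using opr_project_line[OF K L u] opr_on_line[OF body[OF K] body[OF L] x] by (simp add: P)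
  moreover have "inj (\<lambda>s. s *\<^sub>R x)"
    using x by (simp add: inj_on_def)
  ultimately have "(\<lambda>v. v \<bullet> u) ` opr K L = line_opr x ((\<lambda>v. v \<bullet> u) ` K) ((\<lambda>v. v \<bullet> u) ` L)"
    by (simp add: inj_image_eq_iff)
  then show ?thesis
    using line_opr_indep[OF body[OF K] body[OF L] x, of "axis i 1"]
    by (simp add: interval_opr_def axis_eq_0_iff)
qed

lemma GL_covariant: "GL_covariant (Collect (convex_body z)) opr"
  unfolding GL_covariant_def
proof (intro ballI allI impI)
  fix K L :: "(real ^ 'n) set" and A :: "real ^ 'n ^ 'n"
  assume "K \<in> Collect (convex_body z)" "L \<in> Collect (convex_body z)" and A: "invertible A"
  then have K: "convex_body z K" and L: "convex_body z L"
    by auto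
  have AK: "convex_body z ((*v) A ` K)" and AL: "convex_body z ((*v) A ` L)"
    using K L by (auto intro: convex_body_linear_image)
  have eq: "(\<lambda>v. v \<bullet> u) ` (*v) A ` opr K L = (\<lambda>v. v \<bullet> u) ` opr ((*v) A ` K) ((*v) A ` L)"
    if "u \<noteq> 0" for u
  proof -
    \<comment> \<open>Applying \<open>A\<close> and then the functional of \<open>u\<close> is the
      functional of \<open>transpose A *v u\<close>, which is nonzero because \<open>A\<close> is
      invertible. Both sides are then the same value of \<open>interval_opr\<close>.\<close>
    have nz: "transpose A *v u \<noteq> 0"
      using that A left_invertible_transpose[of A] matrix_left_invertible_ker[of "transpose A"]
      unfolding invertible_def by metis
    have "(\<lambda>v. v \<bullet> u) ` (*v) A ` X = (\<lambda>v. v \<bullet> (transpose A *v u)) ` X" for X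
      unfolding image_image by (metis dot_lmul_matrix vector_transpose_matrix)
    then show ?thesis
      using projections_opr[OF K L nz] projections_opr[OF AK AL that] by simp
  qed
  have "convex_body False ((*v) A ` opr K L)" "convex_body False (opr ((*v) A ` K) ((*v) A ` L))"
    using opr_body[OF K L] opr_body[OF AK AL] by (auto intro: convex_body_linear_image)
  then show "(*v) A ` opr K L = opr ((*v) A ` K) ((*v) A ` L)"
    unfolding convex_body_def
    by (intro subset_antisym; rule_tac subset_if_projections_subset) (simp_all add: eq)
qed

section \<open>Subadditivity and monotonicity on intervals through planar bodies\<close>

text \<open>The bodies are embedded in the coordinate plane of \<open>i\<close> and
  \<open>j\<close>, and \<open>Q\<close> is the shadow of their value on that plane. One set
  \<open>Q\<close> thus links the values of \<open>interval_opr\<close> at the images of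
  \<open>R\<close> and \<open>T\<close> under all nonzero functionals.\<close>

lemma ex_planar_realization:
  fixes R T :: "(real \<times> real) set"
  assumes R: "convex_body z R" and T: "convex_body z T"
  obtains Q where "convex_body False (Q :: (real \<times> real) set)"
    and "\<And>a b. (a, b) \<noteq> (0, 0) \<Longrightarrow> (\<lambda>p. a * fst p + b * snd p) ` Q =
      interval_opr ((\<lambda>p. a * fst p + b * snd p) ` R) ((\<lambda>p. a * fst p + b * snd p) ` T)"
proof
  define emb :: "real \<times> real \<Rightarrow> real ^ 'n" where "emb p = fst p *\<^sub>R axis i 1 + snd p *\<^sub>R axis j 1" for p
  define coords :: "real ^ 'n \<Rightarrow> real \<times> real" where "coords v = (v $ i, v $ j)" for v
  let ?Q = "coords ` opr (emb ` R) (emb ` T)"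
  have "linear emb"
    by (rule linearI) (simp_all add: emb_def algebra_simps)
  then have body: "convex_body z (emb ` R)" "convex_body z (emb ` T)"
    using R T by (auto intro: convex_body_linear_image)
  have "linear coords"
    by (rule linearI) (simp_all add: coords_def)
  then show "convex_body False ?Q"
    using opr_body[OF body] by (rule convex_body_linear_image)
  show "(\<lambda>p. a * fst p + b * snd p) ` ?Q =
      interval_opr ((\<lambda>p. a * fst p + b * snd p) ` R) ((\<lambda>p. a * fst p + b * snd p) ` T)"
    if "(a, b) \<noteq> (0, 0)" for a b
  proof -
    define u :: "real ^ 'n" where "u = a *\<^sub>R axis i 1 + b *\<^sub>R axis j 1"
    have ui: "u $ i = a" "u $ j = b"
      using ij by (auto simp: u_def axis_def)
    with that have "u \<noteq> 0"
      by auto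
    moreover have "emb p \<bullet> u = a * fst p + b * snd p" for p
      using ij by (simp add: emb_def inner_add_left inner_axis' ui)
    moreover have "v \<bullet> u = a * fst (coords v) + b * snd (coords v)" for v
      by (simp add: u_def coords_def inner_add_right inner_axis)
    ultimately show ?thesis
      using projections_opr[OF body, of u] by (simp add: image_image)
  qed
qed

text \<open>For the products of the intervals, the functionals x, y and x + y exhibit all three
  values as images of one planar set \<open>Q\<close>, where each coordinate sum lies in the sum of
  the coordinate images.\<close>

lemma interval_opr_plus:
  assumes "convex_body z I" "convex_body z J" "convex_body z I'" "convex_body z J'"
  shows "interval_opr (I + I') (J + J') \<subseteq> interval_opr I J + interval_opr I' J'"
proof -
  have ne: "I \<noteq> {}" "J \<noteq> {}" "I' \<noteq> {}" "J' \<noteq> {}"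
    using assms by (auto simp: convex_body_def)
  obtain Q where "convex_body False (Q :: (real \<times> real) set)"
    and Q: "\<And>a b. (a, b) \<noteq> (0, 0) \<Longrightarrow> (\<lambda>p. a * fst p + b * snd p) ` Q =
      interval_opr ((\<lambda>p. a * fst p + b * snd p) ` (I \<times> I')) ((\<lambda>p. a * fst p + b * snd p) ` (J \<times> J'))"
    using ex_planar_realization[OF convex_body_Times[OF assms(1,3)] convex_body_Times[OF assms(2,4)]]
    by blast
  have "fst ` Q = interval_opr I J" "snd ` Q = interval_opr I' J'"
    using Q[of 1 0] Q[of 0 1] ne by simp_all
  moreover have "interval_opr (I + I') (J + J') = (\<lambda>p. fst p + snd p) ` Q"
    using Q[of 1 1] by (simp add: set_plus_image case_prod_unfold)
  moreover have "(\<lambda>p. fst p + snd p) ` Q \<subseteq> fst ` Q + snd ` Q"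
    by (auto intro!: set_plus_intro intro: rev_image_eqI)
  ultimately show ?thesis
    by simp
qed

text \<open>The planar set \<open>R I I' = {(x, y) \<in> I \<times> I'. (1 + t) x - t y \<in> I}\<close> projects onto \<open>I\<close> under both
  \<open>x\<close> and \<open>(1 + t) x - t y\<close>, and onto \<open>I'\<close> under \<open>y\<close>. In the value \<open>Q\<close> of the operation, a point
  maximizing \<open>x\<close> then satisfies \<open>(1 + t) x - t y \<le> x\<close>, that is \<open>x \<le> y\<close>; likewise for the minimum.\<close>

lemma interval_opr_mono_aux:
  assumes body: "convex_body z I" "convex_body z J" "convex_body z I'" "convex_body z J'"
    and sub: "I \<subseteq> I'" "J \<subseteq> J'" and "0 < t"
    and I: "\<And>y. y \<in> I' \<Longrightarrow> \<exists>x\<in>I. (1 + t) * x - t * y \<in> I"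
    and J: "\<And>y. y \<in> J' \<Longrightarrow> \<exists>x\<in>J. (1 + t) * x - t * y \<in> J"
  shows "interval_opr I J \<subseteq> interval_opr I' J'"
proof
  define R where "R X Y = (X \<times> Y) \<inter> (\<lambda>p. (1 + t) * fst p + (- t) * snd p) -` X" for X Y :: "real set"
  have R_body: "convex_body z (R X Y)"
    if X: "convex_body z X" and Y: "convex_body z Y" and "X \<subseteq> Y" for X Y
    unfolding convex_body_def
  proof (intro conjI impI)
    have lin: "linear (\<lambda>p. (1 + t) * fst p + (- t) * snd p)"
      by (rule linearI) (simp_all add: algebra_simps)
    show "compact (R X Y)" unfolding R_def
      using X Y
      by (intro compact_Int_closed compact_Times closed_vimage continuous_intros)
        (auto simp: convex_body_def compact_imp_closed)
    show "convex (R X Y)" unfolding R_def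
      using X Y by (intro convex_Int convex_Times convex_linear_vimage lin) (auto simp: convex_body_def)
    obtain a where "a \<in> X"
      using X by (auto simp: convex_body_def)
    \<comment> \<open>On the diagonal, (1 + t) x - t y equals x.\<close>
    then have "(a, a) \<in> R X Y"
      using \<open>X \<subseteq> Y\<close> by (auto simp: R_def algebra_simps)
    then show "R X Y \<noteq> {}"
      by blast
    show "0 \<in> R X Y" if z
      using X Y that by (simp add: R_def convex_body_def zero_prod_def)
  qed
  have R_fst: "fst ` R X Y = X" and R_dif: "(\<lambda>p. (1 + t) * fst p + (- t) * snd p) ` R X Y = X"
    if "X \<subseteq> Y" for X Y
  proof -
    have "(a, a) \<in> R X Y" if "a \<in> X" for a
      using that \<open>X \<subseteq> Y\<close> by (auto simp: R_def algebra_simps)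
    then show "fst ` R X Y = X" "(\<lambda>p. (1 + t) * fst p + (- t) * snd p) ` R X Y = X"
      by (force simp: R_def algebra_simps intro: image_eqI[where x = "(a, a)" for a])+
  qed
  \<comment> \<open>The reflection hypotheses enter here: they provide a point of
    \<open>R X Y\<close> above every \<open>y\<close>.\<close>
  have R_snd: "snd ` R X Y = Y" if "\<And>y. y \<in> Y \<Longrightarrow> \<exists>x\<in>X. (1 + t) * x - t * y \<in> X" for X Y
    using that by (force simp: R_def)
  obtain Q where Q_body: "convex_body False (Q :: (real \<times> real) set)"
    and Q: "\<And>a b. (a, b) \<noteq> (0, 0) \<Longrightarrow> (\<lambda>p. a * fst p + b * snd p) ` Q =
      interval_opr ((\<lambda>p. a * fst p + b * snd p) ` R I I') ((\<lambda>p. a * fst p + b * snd p) ` R J J')"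
    using ex_planar_realization[OF R_body[OF body(1,3) sub(1)] R_body[OF body(2,4) sub(2)]] by blast
  have Q_fst: "fst ` Q = interval_opr I J"
    using Q[of 1 0] by (simp add: R_fst sub)
  have Q_snd: "snd ` Q = interval_opr I' J'"
    using Q[of 0 1] by (simp add: R_snd I J)
  have Q_dif: "(\<lambda>p. (1 + t) * fst p + (- t) * snd p) ` Q = fst ` Q"
    using Q[of "1 + t" "- t"] \<open>0 < t\<close> R_dif[OF sub(1)] R_dif[OF sub(2)] Q_fst by simp
  have dif: "(1 + t) * fst p - t * snd p \<in> fst ` Q" if "p \<in> Q" for p
    using imageI[OF that, of "\<lambda>p. (1 + t) * fst p + (- t) * snd p"] unfolding Q_dif by simp
  have comp: "compact (fst ` Q)" "fst ` Q \<noteq> {}" and conv: "convex (snd ` Q)"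
    using convex_body_linear_image[OF linear_fst Q_body] convex_body_linear_image[OF linear_snd Q_body]
    by (auto simp: convex_body_def)
  fix s assume s: "s \<in> interval_opr I J"
  obtain p where p: "p \<in> Q" "\<forall>x\<in>fst ` Q. x \<le> fst p"
    using compact_attains_sup[OF comp] by blast
  obtain q where q: "q \<in> Q" "\<forall>x\<in>fst ` Q. fst q \<le> x"
    using compact_attains_inf[OF comp] by blast
  have "(1 + t) * fst p - t * snd p \<le> fst p"
    using p dif by blast
  then have "t * fst p \<le> t * snd p"
    by (simp add: algebra_simps)
  then have "fst p \<le> snd p"
    using \<open>0 < t\<close> by simp
  moreover have "fst q \<le> (1 + t) * fst q - t * snd q"
    using q dif by blast
  then have "t * snd q \<le> t * fst q"
    by (simp add: algebra_simps)
  then have "snd q \<le> fst q"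
    using \<open>0 < t\<close> by simp
  moreover have "fst q \<le> s" "s \<le> fst p"
    using s p q by (auto simp flip: Q_fst)
  \<comment> \<open>\<open>s\<close> lies between \<open>snd q\<close> and \<open>snd p\<close>,
    both in the convex second projection of \<open>Q\<close>.\<close>
  ultimately have "s \<in> snd ` Q"
    using conv p(1) q(1) convexD_alt mem_is_interval_1_I[of "snd ` Q" "snd q" "snd p" s]
    by (simp add: is_interval_convex_1)
  then show "s \<in> interval_opr I' J'"
    by (simp add: Q_snd)
qed

text \<open>The reflection hypotheses of the previous lemma fail in general for \<open>I \<subseteq> I'\<close> (for example if \<open>I\<close>
  is a single point), but they hold for \<open>(1 - t) I + t I'\<close> in place of \<open>I\<close> when \<open>t > 0\<close>. The limit
  \<open>t \<rightarrow> 0\<close> is taken along the functionals \<open>(1 - t) x + t y\<close> of one fixed planar body.\<close>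

lemma interval_opr_mono:
  assumes body: "convex_body z I" "convex_body z J" "convex_body z I'" "convex_body z J'"
    and sub: "I \<subseteq> I'" "J \<subseteq> J'"
  shows "interval_opr I J \<subseteq> interval_opr I' J'"
proof
  define mix where "mix t X Y = (\<lambda>p. (1 - t) * fst p + t * snd p) ` (X \<times> Y)" for t and X Y :: "real set"
  have mix_body: "convex_body z (mix t X Y)" if "convex_body z X" "convex_body z Y" for t X Y
    unfolding mix_def using convex_body_Times[OF that]
    by (rule convex_body_linear_image[rotated]) (auto intro!: linearI simp: algebra_simps)
  have mix_sub: "mix t X Y \<subseteq> Y" if "convex_body z Y" "X \<subseteq> Y" "0 < t" "t \<le> 1" for t X Y
    using that by (auto simp: mix_def convex_body_def convex_alt)
  have mix_refl: "\<exists>x\<in>mix t X Y. (1 + t) * x - t * y \<in> mix t X Y"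
    if XY: "convex_body z X" "convex_body z Y" "X \<subseteq> Y" and t: "0 < t" "t \<le> 1" and y: "y \<in> Y" for t X Y y
  proof -
    obtain a where a: "a \<in> X"
      using XY by (auto simp: convex_body_def)
    \<comment> \<open>With x = (1 - t) a + t y, the reflection (1 + t) x - t y equals (1 - t) a + t
      x, again a mixture because x lies in \<open>Y\<close>.\<close>
    have "(1 - t) * a + t * y \<in> mix t X Y"
      using a y by (force simp: mix_def)
    moreover have "(1 - t) * a + t * y \<in> Y"
      using XY a y t by (auto simp: convex_body_def convex_alt)
    then have "(1 - t) * a + t * ((1 - t) * a + t * y) \<in> mix t X Y"
      using a by (force simp: mix_def)
    then have "(1 + t) * ((1 - t) * a + t * y) - t * y \<in> mix t X Y"
      by (simp add: algebra_simps)
    ultimately show ?thesis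
      by blast
  qed
  have mono: "interval_opr (mix t I I') (mix t J J') \<subseteq> interval_opr I' J'" if t: "0 < t" "t \<le> 1" for t
    by (rule interval_opr_mono_aux[where t = t])
      (use body sub t mix_body mix_sub mix_refl in \<open>simp_all\<close>)
  obtain Q where Q_body: "convex_body False (Q :: (real \<times> real) set)"
    and Q: "\<And>a b. (a, b) \<noteq> (0, 0) \<Longrightarrow> (\<lambda>p. a * fst p + b * snd p) ` Q =
      interval_opr ((\<lambda>p. a * fst p + b * snd p) ` (I \<times> I')) ((\<lambda>p. a * fst p + b * snd p) ` (J \<times> J'))"
    using ex_planar_realization[OF convex_body_Times[OF body(1,3)] convex_body_Times[OF body(2,4)]]
    by blast
  have ne: "I' \<noteq> {}" "J' \<noteq> {}"
    using body by (auto simp: convex_body_def)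
  have "closed (interval_opr I' J')"
  proof -
    have "snd ` Q = interval_opr I' J'"
      using Q[of 0 1] body by (simp add: convex_body_def)
    then show ?thesis
      using convex_body_linear_image[OF linear_snd Q_body] by (simp add: convex_body_def compact_imp_closed)
  qed
  have "fst ` Q = interval_opr I J"
    using Q[of 1 0] ne by simp
  moreover fix s assume "s \<in> interval_opr I J"
  ultimately obtain p where p: "p \<in> Q" "s = fst p"
    by blast
  \<comment> \<open>The image of \<open>Q\<close> under the mixing functional is the value at the
    mixed intervals, which \<open>mono\<close> bounds. At \<open>p\<close> this functional tends to
    \<open>fst p\<close>, and the bounding set is closed.\<close>
  define t where "t m = 1 / real (Suc m)" for m
  have "(1 - t m) * fst p + t m * snd p \<in> interval_opr I' J'" for m
  proof -
    have t: "0 < t m" "t m \<le> 1"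
      by (auto simp: t_def)
    then have "(\<lambda>p. (1 - t m) * fst p + t m * snd p) ` Q \<subseteq> interval_opr I' J'"
      using Q[of "1 - t m" "t m"] mono[OF t] by (simp add: mix_def)
    then show ?thesis
      using p by blast
  qed
  moreover have "(\<lambda>m. (1 - t m) * fst p + t m * snd p) \<longlonglongrightarrow> (1 - 0) * fst p + 0 * snd p"
    unfolding t_def by (intro tendsto_intros LIMSEQ_Suc[OF lim_const_over_n])
  ultimately show "s \<in> interval_opr I' J'"
    using closed_sequentially[OF \<open>closed (interval_opr I' J')\<close>] p by force
qed

section \<open>Monotonicity, subadditivity and continuity on convex bodies\<close>

lemma opr_mono:
  assumes K: "convex_body z K" "convex_body z K'" "K \<subseteq> K'" and L: "convex_body z L" "convex_body z L'" "L \<subseteq> L'"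
  shows "opr K L \<subseteq> opr K' L'"
proof (rule subset_if_projections_subset)
  show "compact (opr K' L')" "convex (opr K' L')" "opr K' L' \<noteq> {}"
    using opr_body[OF K(2) L(2)] by (auto simp: convex_body_def)
  show "(\<lambda>v. v \<bullet> u) ` opr K L \<subseteq> (\<lambda>v. v \<bullet> u) ` opr K' L'" if "u \<noteq> 0" for u
    using that K L
    by (simp add: projections_opr interval_opr_mono convex_body_inner_image image_mono)
qed

text \<open>Functionals commute with Minkowski sums, so the inclusion for intervals lifts.\<close>

lemma opr_plus:
  assumes K: "convex_body z K" "convex_body z K'" and L: "convex_body z L" "convex_body z L'"
  shows "opr (K + K') (L + L') \<subseteq> opr K L + opr K' L'"
proof (rule subset_if_projections_subset)
  show "compact (opr K L + opr K' L')" "convex (opr K L + opr K' L')" "opr K L + opr K' L' \<noteq> {}"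
    using convex_body_plus[OF opr_body[OF K(1) L(1)] opr_body[OF K(2) L(2)]]
    by (auto simp: convex_body_def)
  have inner_plus: "(\<lambda>v. v \<bullet> u) ` (A + B) = (\<lambda>v. v \<bullet> u) ` A + (\<lambda>v. v \<bullet> u) ` B" for u and A B :: "(real ^ 'n) set"
    by (force simp: set_plus_def inner_add_left)
  show "(\<lambda>v. v \<bullet> u) ` opr (K + K') (L + L') \<subseteq> (\<lambda>v. v \<bullet> u) ` (opr K L + opr K' L')" if "u \<noteq> 0" for u
    using that K L
    by (simp add: projections_opr interval_opr_plus convex_body_inner_image convex_body_plus inner_plus)
qed

lemma hausdorff_continuous: "hausdorff_continuous (Collect (convex_body z)) opr"
proof -
  have unit: "convex_body z (cball (0 :: real ^ 'n) 1)"
    by (rule convex_body_cball) simp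
  then have "bounded (opr (cball 0 1) (cball 0 1))"
    using opr_body by (simp add: convex_body_def compact_imp_bounded)
  then obtain R where R: "\<And>v. v \<in> opr (cball 0 1) (cball 0 1) \<Longrightarrow> norm v \<le> R"
    by (auto simp: bounded_iff)
  \<comment> \<open>For positive \<open>e\<close> the dilation by \<open>e\<close> is invertible, so
    GL covariance scales the bound \<open>R\<close> from the unit ball.\<close>
  have opr_cball: "opr (cball 0 e) (cball 0 e) \<subseteq> cball 0 (e * R)" if "0 < e" for e
  proof -
    have "opr ((*\<^sub>R) e ` cball 0 1) ((*\<^sub>R) e ` cball 0 1) = (*\<^sub>R) e ` opr (cball 0 1) (cball 0 1)"
      using GL_covariant unit that by (intro GL_covariant_scaleR) auto
    then show ?thesis
      using that R by (auto simp: cball_scale)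
  qed
  have sub: "opr K L \<subseteq> opr K' L' + cball 0 (e * R)"
    if "convex_body z K" "convex_body z K'" "convex_body z L" "convex_body z L'"
      "hausdorff_dist K K' \<le> e" "hausdorff_dist L L' \<le> e" "0 < e" for K K' L L' e
  proof -
    have cball: "convex_body z (cball (0 :: real ^ 'n) e)"
      using \<open>0 < e\<close> by (simp add: convex_body_cball)
    have "opr K L \<subseteq> opr (K' + cball 0 e) (L' + cball 0 e)"
      using that
      by (intro opr_mono convex_body_plus cball subset_plus_cball_hausdorff_dist)
        (auto simp: convex_body_def)
    also have "\<dots> \<subseteq> opr K' L' + opr (cball 0 e) (cball 0 e)"
      using that by (intro opr_plus cball)
    also have "\<dots> \<subseteq> opr K' L' + cball 0 (e * R)"
      using opr_cball \<open>0 < e\<close> by (intro set_plus_mono2) auto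
    finally show ?thesis .
  qed
  have le: "hausdorff_dist (opr K L) (opr K' L') \<le> e * R"
    if "convex_body z K" "convex_body z K'" "convex_body z L" "convex_body z L'"
      "hausdorff_dist K K' \<le> e" "hausdorff_dist L L' \<le> e" "0 < e" for K K' L L' e
  proof (rule hausdorff_dist_le_plus_cball)
    show "opr K L \<noteq> {}" "opr K' L' \<noteq> {}"
      using opr_body that by (auto simp: convex_body_def)
    show "opr K L \<subseteq> opr K' L' + cball 0 (e * R)"
      by (rule sub) fact+
    show "opr K' L' \<subseteq> opr K L + cball 0 (e * R)"
      using that by (intro sub) (simp_all add: hausdorff_dist_commute[of K' K] hausdorff_dist_commute[of L' L])
  qed
  show ?thesis
    unfolding hausdorff_continuous_def
  proof (intro allI impI, elim conjE)
    fix Ks Ls and K L :: "(real ^ 'n) set"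
    assume "range Ks \<subseteq> Collect (convex_body z)" "range Ls \<subseteq> Collect (convex_body z)"
      "K \<in> Collect (convex_body z)" "L \<in> Collect (convex_body z)"
      and lim: "hausdorff_tendsto Ks K" "hausdorff_tendsto Ls L"
    then have body: "convex_body z (Ks m)" "convex_body z K" "convex_body z (Ls m)" "convex_body z L" for m
      by auto
    \<comment> \<open>The last summand keeps \<open>e m\<close> positive even when both distances
      vanish, as the estimate \<open>le\<close> requires.\<close>
    define e where "e m = hausdorff_dist (Ks m) K + hausdorff_dist (Ls m) L + 1 / real (Suc m)" for m
    have nonneg: "0 \<le> hausdorff_dist (Ks m) K" "0 \<le> hausdorff_dist (Ls m) L"
      "0 \<le> hausdorff_dist (opr (Ks m) (Ls m)) (opr K L)" for m
      using body(1,3)[of m] body(2,4) opr_body[OF body(1)[of m] body(3)[of m]] opr_body[OF body(2,4)]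
      by (auto intro!: hausdorff_dist_nonneg simp: convex_body_def)
    have pos: "0 < 1 / real (Suc m)" for m
      by simp
    have "hausdorff_dist (Ks m) K \<le> e m" "hausdorff_dist (Ls m) L \<le> e m" "0 < e m" for m
      using nonneg[of m] pos[of m] unfolding e_def by linarith+
    then have "hausdorff_dist (opr (Ks m) (Ls m)) (opr K L) \<le> e m * R" for m
      by (rule le[OF body])
    moreover have "e \<longlonglongrightarrow> 0 + 0 + 0"
      using lim unfolding hausdorff_tendsto_def e_def
      by (intro tendsto_add LIMSEQ_Suc[OF lim_const_over_n])
    then have "(\<lambda>m. e m * R) \<longlonglongrightarrow> 0"
      using tendsto_mult_right[of e 0 sequentially R] by simp
    ultimately show "hausdorff_tendsto (\<lambda>m. opr (Ks m) (Ls m)) (opr K L)"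
      unfolding hausdorff_tendsto_def using nonneg(3)
      by (rule_tac tendsto_sandwich[where f = "\<lambda>_. 0" and h = "\<lambda>m. e m * R"])
        (simp_all add: always_eventually)
  qed
qed

end

section \<open>The equivalence and homogeneity of degree 1\<close>

theorem corollary9p9:
  fixes C :: "(real ^ 'n) set set"
    and opr :: "(real ^ 'n) set \<Rightarrow> (real ^ 'n) set \<Rightarrow> (real ^ 'n) set"
  assumes "CARD('n) \<ge> 2"
    and "C = compact_convex_sets \<or> C = compact_convex_sets_o"
    and "\<And>K L. K \<in> C \<Longrightarrow> L \<in> C \<Longrightarrow> opr K L \<in> compact_convex_sets"
  shows "(projection_covariant C opr \<longleftrightarrow> hausdorff_continuous C opr \<and> GL_covariant C opr) \<and>
    (hausdorff_continuous C opr \<and> GL_covariant C opr \<longrightarrow> homogeneous_degree_1 C opr)"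
proof -
  have sets: "compact_convex_sets = Collect (convex_body False)"
    "compact_convex_sets_o = Collect (convex_body True)"
    by (auto simp: compact_convex_sets_def compact_convex_sets_o_def convex_body_def)
  then obtain z where C: "C = Collect (convex_body z)"
    using assms(2) by blast
  have opr: "convex_body False (opr K L)" if "K \<in> C" "L \<in> C" for K L
    using assms(3)[OF that] by (simp add: sets)
  obtain i j :: 'n where ij: "i \<noteq> j"
    using assms(1) card_le_Suc0_iff_eq[of "UNIV :: 'n set"] by auto
  show ?thesis
  proof (intro conjI iffI impI; (elim conjE)?)
    assume "projection_covariant C opr"
    then interpret projection_covariant_operation z opr i j
      using opr ij by unfold_locales (auto simp: C)
    show "hausdorff_continuous C opr" "GL_covariant C opr"
      using hausdorff_continuous GL_covariant by (simp_all add: C)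
  next
    assume "hausdorff_continuous C opr" "GL_covariant C opr"
    then show "projection_covariant C opr"
      unfolding projection_covariant_def
      using projection_covariant_if_continuous_GL_covariant[of C z opr] C opr by blast
  next
    assume cont: "hausdorff_continuous C opr" and GL: "GL_covariant C opr"
    \<comment> \<open>Dilation by 0 is not in GL(n), but it is the projection onto
      \<open>{0}\<close>, so the limit argument for projections covers r = 0.\<close>
    have zero: "orth_proj {0} = (*\<^sub>R) (0 :: real)"
      by (auto simp: fun_eq_iff orthogonal_def intro: orth_proj_eqI)
    show "homogeneous_degree_1 C opr"
      unfolding homogeneous_degree_1_def
    proof (intro ballI allI impI)
      fix K L and r :: real
      assume KL: "K \<in> C" "L \<in> C" and "0 \<le> r"
      show "opr ((*\<^sub>R) r ` K) ((*\<^sub>R) r ` L) = (*\<^sub>R) r ` opr K L"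
      proof (cases "r = 0")
        case True
        then show ?thesis
          using projection_covariant_if_continuous_GL_covariant[of C z opr K L "{0}"] C opr cont GL KL
          by (simp add: zero)
      qed (use GL_covariant_scaleR GL KL in blast)
    qed
  qed
qed

end
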